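(* Let $k\geq 1$ be an integer. For every graph $G$ with minimum degree $\delta(G)\geq k-1$ and maximum degree $\Delta(G)$, $$\gamma_{kS}(G) \geq |V(G)|\cdot\frac{\delta(G)-\Delta(G)+2k+I_{\delta(G)}+I_{\Delta(G)}}{\delta(G)+\Delta(G)+2+I_{\delta(G)}-I_{\Delta(G)}}\;.$$
   Context: All graphs are finite, simple and undirected, with nonempty vertex set. For each integer $n$, $I_n=1$ if $n\equiv k\pmod 2$, and $I_n=0$ otherwise. For a vertex $v$ of $G$, $N_G[v]$ denotes the closed neighborhood of $v$ (the set consisting of $v$ and all vertices adjacent to $v$). For $G$ of minimum degree at least $k-1$, a function $f:V(G)\rightarrow\{-1,1\}$ is a signed $k$-dominating function of $G$ if $\sum_{u\in N_G[v]}f(u)\geq k$ for all $v\in V(G)$. The signed $k$-domination number $\gamma_{kS}(G)$ is the minimum of $\sum_{v\in V(G)}f(v)$ over all signed $k$-dominating functions $f$ of $G$. *)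

theory Defs
  imports Complex_Main "Graph_Theory.Digraph" "HOL-Library.FuncSet" "HOL-Number_Theory.Cong"
begin

(* Finite simple undirected graphs are the locale graph: finite, loop-free symmetric digraphs
   without parallel arcs. An edge uv is the pair of opposite arcs between u and v, so the degree
   of v is out_degree G v (see out_degree_eq_card_nbhd). *)

definition closed_nbhd :: "('a, 'b) pre_digraph \<Rightarrow> 'a \<Rightarrow> 'a set" where
  "closed_nbhd G v = insert v {u. v \<rightarrow>\<^bsub>G\<^esub> u}"

definition min_degree :: "('a, 'b) pre_digraph \<Rightarrow> nat" where
  "min_degree G = Min (out_degree G ` verts G)"

definition max_degree :: "('a, 'b) pre_digraph \<Rightarrow> nat" where
  "max_degree G = Max (out_degree G ` verts G)"

definition parity_ind :: "int \<Rightarrow> int \<Rightarrow> int" where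
  "parity_ind k n = (if [n = k] (mod 2) then 1 else 0)"

(* Extensional functions, so that each f is determined by its values on the vertices. *)
definition signed_k_dominating :: "int \<Rightarrow> ('a, 'b) pre_digraph \<Rightarrow> ('a \<Rightarrow> int) \<Rightarrow> bool" where
  "signed_k_dominating k G f \<longleftrightarrow>
     f \<in> verts G \<rightarrow>\<^sub>E {-1, 1} \<and> (\<forall>v\<in>verts G. (\<Sum>u\<in>closed_nbhd G v. f u) \<ge> k)"

(* Min is meaningful only on a finite nonempty set; see finite_signed_k_dominating and
   signed_k_dominating_exists. *)
definition signed_k_domination_number :: "int \<Rightarrow> ('a, 'b) pre_digraph \<Rightarrow> int" where
  "signed_k_domination_number k G =
     Min ((\<lambda>f. \<Sum>v\<in>verts G. f v) ` {f. signed_k_dominating k G f})"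

lemma (in graph) out_degree_eq_card_nbhd: "out_degree G v = card {u. v \<rightarrow>\<^bsub>G\<^esub> u}"
proof -
  have "bij_betw (head G) (out_arcs G v) {u. v \<rightarrow>\<^bsub>G\<^esub> u}"
    using no_multi_arcs
    by (fastforce simp: bij_betw_def inj_on_def arcs_ends_def arc_to_ends_def out_arcs_def)
  then show ?thesis
    unfolding out_degree_def by (rule bij_betw_same_card)
qed

lemma (in graph) finite_signed_k_dominating: "finite {f. signed_k_dominating k G f}"
  by (rule finite_subset[OF _ finite_PiE[of "verts G" "\<lambda>_. {-1, 1 :: int}"]])
    (auto simp: signed_k_dominating_def)

lemma (in graph) signed_k_dominating_exists:
  assumes "int (min_degree G) \<ge> k - 1"
  shows "{f. signed_k_dominating k G f} \<noteq> {}"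
proof -
  let ?f = "\<lambda>v. if v \<in> verts G then 1 else undefined :: int"
  have "(\<Sum>u\<in>closed_nbhd G v. ?f u) \<ge> k" if v: "v \<in> verts G" for v
  proof -
    have sub: "{u. v \<rightarrow>\<^bsub>G\<^esub> u} \<subseteq> verts G"
      by (auto simp: arcs_ends_def arc_to_ends_def)
    have fin: "finite {u. v \<rightarrow>\<^bsub>G\<^esub> u}"
      by (rule finite_subset[OF sub]) simp
    have nin: "v \<notin> {u. v \<rightarrow>\<^bsub>G\<^esub> u}"
      using no_loops by (fastforce simp: arcs_ends_def arc_to_ends_def)
    have "(\<Sum>u\<in>closed_nbhd G v. ?f u) = (\<Sum>u\<in>closed_nbhd G v. 1)"
      by (rule sum.cong) (use sub v in \<open>auto simp: closed_nbhd_def\<close>)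
    also have "\<dots> = int (out_degree G v) + 1"
      using fin nin by (simp add: closed_nbhd_def out_degree_eq_card_nbhd)
    finally have "(\<Sum>u\<in>closed_nbhd G v. ?f u) = int (out_degree G v) + 1" .
    moreover have "min_degree G \<le> out_degree G v"
      using v by (simp add: min_degree_def)
    ultimately show ?thesis
      using assms by linarith
  qed
  then have "signed_k_dominating k G ?f"
    by (auto simp: signed_k_dominating_def)
  then show ?thesis by blast
qed

end

theory Submission
  imports Defs
begin

text \<open>
  The sum \<open>f(N[v])\<close> has the parity of \<open>d(v) + 1\<close>, so domination improves to
  \<open>f(N[v]) \<ge> k + I\<^bsub>d(v)\<^esub>\<close>. Summing over all \<open>v\<close> and exchanging the order of summation gives
  \<open>\<Sum>\<^sub>v (f(v) (d(v) + 1) - k - I\<^bsub>d(v)\<^esub>) \<ge> 0\<close>. Both \<open>d - I\<^bsub>d\<^esub>\<close> and \<open>d + I\<^bsub>d\<^esub>\<close> are nondecreasing in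
  \<open>d\<close>, so the summand is at most \<open>A = \<Delta> + 1 - k - I\<^bsub>\<Delta>\<^esub>\<close> where \<open>f(v) = 1\<close> and at most
  \<open>-B = -(\<delta> + 1 + k + I\<^bsub>\<delta>\<^esub>)\<close> where \<open>f(v) = -1\<close>. With \<open>n\<close> the number of vertices and \<open>w = f(V)\<close>
  this reads \<open>(n + w) A \<ge> (n - w) B\<close>, and solving for \<open>w\<close> gives the bound.
\<close>

lemma parity_ind_cases: "parity_ind k n = 0 \<or> parity_ind k n = 1"
  by (simp add: parity_ind_def)

text \<open>For distinct integers the gap is at least 1, which absorbs any change of the indicator.
  The same reason gives \<open>add_parity_ind_mono\<close>.\<close>

lemma diff_parity_ind_mono:
  assumes "m \<le> n"
  shows "m - parity_ind k m \<le> n - parity_ind k n"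
  using assms parity_ind_cases[of k m] parity_ind_cases[of k n] by (cases "m = n") auto

lemma add_parity_ind_mono:
  assumes "m \<le> n"
  shows "m + parity_ind k m \<le> n + parity_ind k n"
  using assms parity_ind_cases[of k m] parity_ind_cases[of k n] by (cases "m = n") auto

lemma even_sum_signs_iff:
  fixes f :: "'a \<Rightarrow> int"
  assumes "finite A" "\<And>x. x \<in> A \<Longrightarrow> f x \<in> {-1, 1}"
  shows "even (\<Sum>x\<in>A. f x) \<longleftrightarrow> even (card A)"
  using assms
proof (induction A rule: finite_induct)
  case (insert x F)
  have "odd (f x)"
    using insert.prems[of x] by auto
  moreover have "even (\<Sum>x\<in>F. f x) \<longleftrightarrow> even (card F)"
    using insert by simp
  ultimately show ?case
    using insert.hyps by simp
qed simp

context graph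
begin

lemma closed_nbhd_subset: "v \<in> verts G \<Longrightarrow> closed_nbhd G v \<subseteq> verts G"
  by (auto simp: closed_nbhd_def arcs_ends_def arc_to_ends_def)

lemma finite_closed_nbhd: "v \<in> verts G \<Longrightarrow> finite (closed_nbhd G v)"
  by (rule finite_subset[OF closed_nbhd_subset]) simp_all

lemma closed_nbhd_commute: "u \<in> closed_nbhd G v \<longleftrightarrow> v \<in> closed_nbhd G u"
  unfolding closed_nbhd_def using arcs_ends_symmetric[OF sym_arcs] by blast

lemma card_closed_nbhd:
  assumes "v \<in> verts G"
  shows "card (closed_nbhd G v) = Suc (out_degree G v)"
proof -
  have "v \<notin> {u. v \<rightarrow>\<^bsub>G\<^esub> u}"
    using no_loops by (fastforce simp: arcs_ends_def arc_to_ends_def)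
  then show ?thesis
    using finite_closed_nbhd[OF assms] by (simp add: closed_nbhd_def out_degree_eq_card_nbhd)
qed

text \<open>Double counting: by symmetry of adjacency, \<open>f u\<close> is counted once for each v
  in the closed neighborhood of u, which has one element more than the degree of u.\<close>

lemma sum_closed_nbhd_swap:
  fixes f :: "'a \<Rightarrow> int"
  shows "(\<Sum>v\<in>verts G. \<Sum>u\<in>closed_nbhd G v. f u) = (\<Sum>u\<in>verts G. f u * (int (out_degree G u) + 1))"
proof -
  have eq: "{u \<in> verts G. u \<in> closed_nbhd G v} = closed_nbhd G v" if "v \<in> verts G" for v
    using closed_nbhd_subset[OF that] by blast
  have "(\<Sum>v\<in>verts G. \<Sum>u\<in>closed_nbhd G v. f u)
      = (\<Sum>v\<in>verts G. \<Sum>u | u \<in> verts G \<and> u \<in> closed_nbhd G v. f u)"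
    by (rule sum.cong) (simp_all add: eq)
  also have "\<dots> = (\<Sum>u\<in>verts G. \<Sum>v | v \<in> verts G \<and> u \<in> closed_nbhd G v. f u)"
    by (rule sum.swap_restrict) simp_all
  also have "\<dots> = (\<Sum>u\<in>verts G. \<Sum>v\<in>closed_nbhd G u. f u)"
  proof (rule sum.cong)
    fix u assume "u \<in> verts G"
    then have "{v \<in> verts G. u \<in> closed_nbhd G v} = closed_nbhd G u"
      using eq closed_nbhd_commute by blast
    then show "(\<Sum>v | v \<in> verts G \<and> u \<in> closed_nbhd G v. f u) = (\<Sum>v\<in>closed_nbhd G u. f u)"
      by simp
  qed simp
  also have "\<dots> = (\<Sum>u\<in>verts G. f u * (int (out_degree G u) + 1))"
    by (simp add: card_closed_nbhd algebra_simps)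
  finally show ?thesis .
qed

lemma signed_k_dominating_parity:
  assumes f: "signed_k_dominating k G f" and v: "v \<in> verts G"
  shows "(\<Sum>u\<in>closed_nbhd G v. f u) \<ge> k + parity_ind k (int (out_degree G v))"
proof -
  let ?s = "\<Sum>u\<in>closed_nbhd G v. f u"
  have "f x \<in> {-1, 1}" if "x \<in> closed_nbhd G v" for x
    using f closed_nbhd_subset[OF v] that by (auto simp: signed_k_dominating_def)
  then have "even ?s \<longleftrightarrow> even (Suc (out_degree G v))"
    using even_sum_signs_iff[OF finite_closed_nbhd[OF v], of f] card_closed_nbhd[OF v] by simp
  \<comment> \<open>If the degree is congruent to k, the sum has the parity of k + 1, so it cannot
    equal k; being at least k, it is at least k + 1.\<close>
  then have "?s \<noteq> k" if "[int (out_degree G v) = k] (mod 2)"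
    using that by (auto simp: cong_iff_dvd_diff)
  moreover have "?s \<ge> k"
    using f v by (simp add: signed_k_dominating_def)
  ultimately show ?thesis
    by (auto simp: parity_ind_def)
qed

text \<open>The bound with its denominator cleared, which keeps the argument in the integers and
  holds for every dominating function, minimum or not.\<close>

lemma signed_k_dominating_weight:
  assumes f: "signed_k_dominating k G f"
  defines "\<delta> \<equiv> int (min_degree G)" and "\<Delta> \<equiv> int (max_degree G)"
    and "n \<equiv> int (card (verts G))" and "w \<equiv> \<Sum>v\<in>verts G. f v"
  shows "n * (\<delta> - \<Delta> + 2 * k + parity_ind k \<delta> + parity_ind k \<Delta>)
    \<le> w * (\<delta> + \<Delta> + 2 + parity_ind k \<delta> - parity_ind k \<Delta>)"
proof -
  define A where "A = \<Delta> + 1 - k - parity_ind k \<Delta>"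
  define B where "B = \<delta> + 1 + k + parity_ind k \<delta>"
  let ?d = "\<lambda>v. int (out_degree G v)"
  \<comment> \<open>The weights 1 + f v and 1 - f v are 2 and 0 in one order or the other, so the
    right side is 2A or -2B according to the sign of f v. This makes the case distinction linear in
    f v and easy to sum.\<close>
  have "2 * (f v * (?d v + 1) - (k + parity_ind k (?d v))) \<le> (1 + f v) * A - (1 - f v) * B"
    if v: "v \<in> verts G" for v
  proof -
    have "\<delta> \<le> ?d v" "?d v \<le> \<Delta>"
      using v by (simp_all add: \<delta>_def \<Delta>_def min_degree_def max_degree_def)
    then have "?d v - parity_ind k (?d v) \<le> \<Delta> - parity_ind k \<Delta>"
      "\<delta> + parity_ind k \<delta> \<le> ?d v + parity_ind k (?d v)"
      by (simp_all add: diff_parity_ind_mono add_parity_ind_mono)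
    moreover have "f v = -1 \<or> f v = 1"
      using f v by (auto simp: signed_k_dominating_def)
    ultimately show ?thesis
      by (auto simp: A_def B_def)
  qed
  then have "(\<Sum>v\<in>verts G. 2 * (f v * (?d v + 1) - (k + parity_ind k (?d v))))
      \<le> (\<Sum>v\<in>verts G. (1 + f v) * A - (1 - f v) * B)"
    by (rule sum_mono)
  also have "\<dots> = (n + w) * A - (n - w) * B"
    by (simp add: n_def w_def sum_subtractf sum.distrib flip: sum_distrib_right)
  finally have le: "2 * ((\<Sum>v\<in>verts G. f v * (?d v + 1)) - (\<Sum>v\<in>verts G. k + parity_ind k (?d v)))
      \<le> (n + w) * A - (n - w) * B"
    by (simp only: sum_subtractf flip: sum_distrib_left)
  have "(\<Sum>v\<in>verts G. k + parity_ind k (?d v)) \<le> (\<Sum>v\<in>verts G. f v * (?d v + 1))"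
    unfolding sum_closed_nbhd_swap[symmetric]
    by (rule sum_mono) (rule signed_k_dominating_parity[OF f])
  then have "0 \<le> 2 * ((\<Sum>v\<in>verts G. f v * (?d v + 1)) - (\<Sum>v\<in>verts G. k + parity_ind k (?d v)))"
    by simp
  from this le have "0 \<le> (n + w) * A - (n - w) * B"
    by (rule order_trans)
  \<comment> \<open>The expression equals w(A + B) - n(B - A), where A + B is the denominator and B
    - A the numerator of the bound.\<close>
  then show ?thesis
    by (simp add: A_def B_def algebra_simps)
qed

end

theorem theorem4:
  fixes k :: int and G :: "('a, 'b) pre_digraph"
  assumes "k \<ge> 1"
    and "graph G"
    and "verts G \<noteq> {}"
    and "int (min_degree G) \<ge> k - 1"
  shows "real_of_int (signed_k_domination_number k G) \<ge>
    real (card (verts G)) *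
      (real_of_int (int (min_degree G) - int (max_degree G) + 2 * k
          + parity_ind k (int (min_degree G)) + parity_ind k (int (max_degree G)))
       / real_of_int (int (min_degree G) + int (max_degree G) + 2
          + parity_ind k (int (min_degree G)) - parity_ind k (int (max_degree G))))"
proof -
  interpret graph G by fact
  let ?\<delta> = "int (min_degree G)" and ?\<Delta> = "int (max_degree G)"
  let ?N = "?\<delta> - ?\<Delta> + 2 * k + parity_ind k ?\<delta> + parity_ind k ?\<Delta>"
  let ?D = "?\<delta> + ?\<Delta> + 2 + parity_ind k ?\<delta> - parity_ind k ?\<Delta>"
  let ?w = "signed_k_domination_number k G"
  have "?w \<in> (\<lambda>f. \<Sum>v\<in>verts G. f v) ` {f. signed_k_dominating k G f}"
    unfolding signed_k_domination_number_def
    using finite_signed_k_dominating signed_k_dominating_exists[OF assms(4)]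
    by (intro Min_in) auto
  then obtain f where "signed_k_dominating k G f" "?w = (\<Sum>v\<in>verts G. f v)"
    by auto
  then have "int (card (verts G)) * ?N \<le> ?w * ?D"
    using signed_k_dominating_weight by simp
  then have "real (card (verts G)) * real_of_int ?N \<le> real_of_int ?w * real_of_int ?D"
    by (metis of_int_le_iff of_int_mult of_int_of_nat_eq)
  \<comment> \<open>Degrees are nonnegative and the indicators lower the sum by at most 1, so
    \<open>?D\<close> is at least 1.\<close>
  moreover have "?D > 0"
    using parity_ind_cases[of k ?\<delta>] parity_ind_cases[of k ?\<Delta>] by linarith
  then have "real_of_int ?D > 0"
    by (simp only: of_int_0_less_iff)
  ultimately show ?thesis
    unfolding times_divide_eq_right by (simp only: pos_divide_le_eq)
qed

end
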